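(* Define polynomials $Q_n(x)$, $n\ge1$, by \[ Q_1(x)=x^2,\qquad Q_{n+1}(x) = (n!)^2x^2 +\sum_{j=0}^{n-1}{n \choose j}{n \choose j+1}Q_{j+1}(x)Q_{n-j}(x)\quad(n\ge1). \] Then each $Q_n$ is an even polynomial of degree $2n$ with $Q_n(0)=0$ and nonnegative integer coefficients $q_{n,k}$, i.e. $Q_n(x)=\sum_{k=1}^n q_{n,k}x^{2k}$; the polynomials satisfy \[|Q_n(x)| \le n!(n-1)!\,\max(1,|x|)^{2n};\] and for $b > \max(1, |x|)$, \[ \log I(b,2x)=-\sum_{n=1}^\infty\frac{Q_n(x)}{n!^2}\frac{1}{b^{2n}}= -\sum_{n=1}^\infty \sum_{k=1}^n\frac{q_{n,k}}{n!^2}\frac{x^{2k}}{b^{2n}}, \] the series converging.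
   Context: For real $b>1$ and $x\in\mathbb{C}$ let \[I(b,x) := \frac{1}{2\pi}\int_0^{2\pi}\exp\left(-ix \arg(1-b^{-1}e^{i\theta})\right)d\theta,\] where $\arg$ denotes the principal argument (here in $(-\pi/2,\pi/2)$). The logarithm $\log I(b,2x)$ is the branch analytic in $x$ on $|x|<b$ with value $0$ at $x=0$. *)

theory Defs
  imports "HOL-Complex_Analysis.Complex_Analysis" "HOL-Computational_Algebra.Polynomial"
begin

definition arg_integral :: "real \<Rightarrow> complex \<Rightarrow> complex" where
  "arg_integral b x = 1 / (2 * of_real pi) *
     integral {0..2*pi}
       (\<lambda>\<theta>. exp (- \<i> * x * of_real (Arg (1 - exp (\<i> * of_real \<theta>) / of_real b))))"

text \<open>The logarithm of \<open>arg_integral b (2 * x)\<close> on the disc \<open>\<bar>x\<bar> < b\<close>, analytic in \<open>x\<close> and vanishing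
  at \<open>x = 0\<close>. As the disc is connected, these conditions determine \<open>L\<close> on the disc.\<close>

definition is_log_arg_integral :: "real \<Rightarrow> (complex \<Rightarrow> complex) \<Rightarrow> bool" where
  "is_log_arg_integral b L \<longleftrightarrow>
     L holomorphic_on ball 0 b \<and> L 0 = 0 \<and>
     (\<forall>x\<in>ball 0 b. exp (L x) = arg_integral b (2 * x))"

text \<open>The polynomials are indexed from 1; the value at 0 is a dummy. They are defined over the complex
  numbers, so that integrality of the coefficients is not built into the type.\<close>

fun Q :: "nat \<Rightarrow> complex poly" where
  "Q 0 = 0"
| "Q (Suc 0) = monom 1 2"
| "Q (Suc (Suc m)) = (let n = Suc m in
     monom ((fact n)^2) 2 +
     (\<Sum>j<n. of_nat ((n choose j) * (n choose (j + 1))) * Q (j + 1) * Q (n - j)))"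

lemma Q_1: "Q 1 = monom 1 2"
  by simp

lemma Q_rec:
  assumes "n \<ge> 1"
  shows "Q (n + 1) = monom ((fact n)^2) 2 +
    (\<Sum>j=0..n-1. of_nat ((n choose j) * (n choose (j + 1))) * Q (j + 1) * Q (n - j))"
proof -
  obtain m where m: "n = Suc m"
    using assms by (cases n) auto
  have "{0..n-1} = {..<n}"
    using m by auto
  then show ?thesis
    by (simp only: m Q.simps Let_def add_Suc_right add_0_right One_nat_def)
qed

end

theory Submission imports Defs begin

unbundle no vec_syntax

text \<open>With \<open>u = e\<^sup>i\<^sup>\<theta> / b\<close> the integrand of \<open>I(b, 2x)\<close> is \<open>(1 - u) powr (-x) * (1 - cnj u) powr x\<close>; expanding
  both factors binomially and using orthogonality on the circle,
  \<open>I(b, 2x) = (\<Sum>n. (x gchoose n) * (- x gchoose n) * t\<^sup>n)\<close> with \<open>t = 1 / b\<^sup>2\<close>. This is a hypergeometric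
  series in \<open>t\<close>, and its second-order equation is a Riccati equation for minus its logarithmic derivative.
  Comparing coefficients in the Riccati equation gives exactly the recursion for \<open>Q\<close>, in the form
  \<open>(n + 1) g\<^sub>n = x\<^sup>2 + (\<Sum>j<n. g\<^sub>j g\<^sub>n\<^sub>-\<^sub>1\<^sub>-\<^sub>j)\<close> with \<open>g\<^sub>n = Q\<^sub>n\<^sub>+\<^sub>1(x) / (n! (n + 1)!)\<close>; induction on it yields
  \<open>\<bar>g\<^sub>n\<bar> \<le> max 1 \<bar>x\<bar> ^ (2n + 2)\<close>, hence the bound on \<open>Q\<close> and convergence.\<close>

section \<open>The recursion for the rescaled values of \<open>Q\<close> and their growth\<close>

definition riccati_fps :: "complex \<Rightarrow> complex fps" where
  "riccati_fps x = Abs_fps (\<lambda>n. poly (Q (Suc n)) x / (fact n * fact (Suc n)))"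

lemma riccati_fps_nth_rec:
  "of_nat (Suc n) * riccati_fps x $ n =
     x\<^sup>2 + (\<Sum>j<n. riccati_fps x $ j * riccati_fps x $ (n - 1 - j))"
proof (cases "n = 0")
  case True
  then show ?thesis by (simp add: riccati_fps_def poly_monom)
next
  case False
  have summand: "of_nat ((n choose j) * (n choose (j + 1))) * poly (Q (j + 1)) x * poly (Q (n - j)) x
      = (fact n)\<^sup>2 * (riccati_fps x $ j * riccati_fps x $ (n - 1 - j))" if "j < n" for j
  proof -
    have "of_nat (n choose j) = (fact n / (fact j * fact (n - j)) :: complex)"
      and "of_nat (n choose (j + 1)) = (fact n / (fact (Suc j) * fact (n - 1 - j)) :: complex)"
      and "Suc (n - 1 - j) = n - j"
      using that by (simp_all add: binomial_fact del: fact_Suc)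
    then show ?thesis
      unfolding of_nat_mult riccati_fps_def fps_nth_Abs_fps
      by (simp only:) (simp add: power2_eq_square mult_ac del: fact_Suc)
  qed
  have "poly (Q (n + 1)) x = (fact n)\<^sup>2 * x\<^sup>2 +
      (\<Sum>j=0..n-1. of_nat ((n choose j) * (n choose (j + 1))) * poly (Q (j + 1)) x * poly (Q (n - j)) x)"
    using False by (subst Q_rec) (simp_all add: poly_sum poly_monom)
  also have "{0..n-1} = {..<n}"
    using False by auto
  also have "(\<Sum>j<n. of_nat ((n choose j) * (n choose (j + 1))) * poly (Q (j + 1)) x * poly (Q (n - j)) x)
      = (fact n)\<^sup>2 * (\<Sum>j<n. riccati_fps x $ j * riccati_fps x $ (n - 1 - j))"
    unfolding sum_distrib_left by (intro sum.cong refl summand) simp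
  finally have "poly (Q (Suc n)) x =
      (fact n)\<^sup>2 * (x\<^sup>2 + (\<Sum>j<n. riccati_fps x $ j * riccati_fps x $ (n - 1 - j)))"
    by (simp add: algebra_simps)
  then have "riccati_fps x $ n = (fact n)\<^sup>2 *
      (x\<^sup>2 + (\<Sum>j<n. riccati_fps x $ j * riccati_fps x $ (n - 1 - j))) / (fact n * fact (Suc n))"
    by (simp add: riccati_fps_def)
  then show ?thesis
    by (simp add: power2_eq_square del: of_nat_Suc)
qed

text \<open>Strong induction on the recursion. In each product the exponents
  \<open>2 * j + 2\<close> and \<open>2 * (n - 1 - j) + 2\<close> add up to
  \<open>2 * n + 2\<close>, so each of the \<open>n\<close> products, and \<open>x\<^sup>2\<close>
  as well, is at most \<open>?M ^ (2 * n + 2)\<close>. These \<open>n + 1\<close> terms are balanced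
  exactly by the factor \<open>Suc n\<close> on the left.\<close>

lemma norm_riccati_fps_nth_le: "norm (riccati_fps x $ n) \<le> max 1 (norm x) ^ (2 * n + 2)"
proof (induction n rule: less_induct)
  case (less n)
  let ?M = "max 1 (norm x)"
  have "norm (riccati_fps x $ j * riccati_fps x $ (n - 1 - j)) \<le> ?M ^ (2 * n + 2)" if "j < n" for j
  proof -
    have "norm (riccati_fps x $ j * riccati_fps x $ (n - 1 - j))
        \<le> ?M ^ (2 * j + 2) * ?M ^ (2 * (n - 1 - j) + 2)"
      unfolding norm_mult using that by (intro mult_mono less) auto
    also have "\<dots> = ?M ^ (2 * n + 2)"
    proof -
      have "2 * j + 2 + (2 * (n - 1 - j) + 2) = 2 * n + 2"
        using that by simp
      then show ?thesis
        by (simp only: power_add[symmetric])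
    qed
    finally show ?thesis .
  qed
  then have "norm (\<Sum>j<n. riccati_fps x $ j * riccati_fps x $ (n - 1 - j)) \<le> of_nat (card {..<n}) * ?M ^ (2 * n + 2)"
    by (intro sum_norm_bound) auto
  moreover have "norm (x\<^sup>2) \<le> ?M ^ (2 * n + 2)"
  proof -
    have "norm (x\<^sup>2) \<le> ?M ^ 2"
      by (simp add: norm_power power_mono)
    also have "\<dots> \<le> ?M ^ (2 * n + 2)"
      by (intro power_increasing) auto
    finally show ?thesis .
  qed
  ultimately have "norm (of_nat (Suc n) * riccati_fps x $ n) \<le> real (Suc n) * ?M ^ (2 * n + 2)"
    unfolding riccati_fps_nth_rec
    by (intro order_trans[OF norm_triangle_ineq]) (simp add: algebra_simps)
  then show ?case
    unfolding norm_mult norm_of_nat by (rule mult_left_le_imp_le) simp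
qed

lemma norm_poly_Q_le:
  assumes "n \<ge> 1"
  shows "norm (poly (Q n) x) \<le> fact n * fact (n - 1) * max 1 (norm x) ^ (2 * n)"
proof -
  obtain m where m: "n = Suc m"
    using assms by (cases n) auto
  have "norm (poly (Q (Suc m)) x) / (fact m * fact (Suc m)) \<le> max 1 (norm x) ^ (2 * m + 2)"
    using norm_riccati_fps_nth_le[of x m]
    by (simp add: riccati_fps_def norm_divide norm_mult del: fact_Suc of_nat_Suc)
  then show ?thesis
    by (simp add: m divide_le_eq mult_ac del: fact_Suc of_nat_Suc)
qed

section \<open>From the Riccati equation to the hypergeometric coefficients\<close>

lemma riccati_fps_ode:
  "(1 - fps_X) * (fps_X * fps_deriv (riccati_fps x) + riccati_fps x - fps_X * riccati_fps x ^ 2)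
     = fps_const (x\<^sup>2)"
proof -
  let ?G = "riccati_fps x"
  \<comment> \<open>The recursion read as an identity of power series: its term
    \<open>x\<^sup>2\<close>, present in every coefficient, is the geometric series of x^2 / (1 -
    X). Multiplying by 1 - X then removes the denominator.\<close>
  have "fps_X * fps_deriv ?G + ?G - fps_X * ?G ^ 2 = fps_const (x\<^sup>2) * Abs_fps (\<lambda>_. 1)"
  proof (rule fps_ext)
    fix n
    have "(fps_X * ?G ^ 2) $ n = (\<Sum>j<n. ?G $ j * ?G $ (n - 1 - j))"
      by (cases n)
        (simp_all add: power2_eq_square fps_mult_nth[of ?G] atLeast0AtMost lessThan_Suc_atMost)
    moreover have "(fps_X * fps_deriv ?G + ?G) $ n = of_nat (Suc n) * ?G $ n"
      by (cases n) (simp_all add: algebra_simps)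
    ultimately show "(fps_X * fps_deriv ?G + ?G - fps_X * ?G ^ 2) $ n
        = (fps_const (x\<^sup>2) * Abs_fps (\<lambda>_. 1)) $ n"
      using riccati_fps_nth_rec[of n x] by simp
  qed
  moreover have "(1 - fps_X) * Abs_fps (\<lambda>_. 1 :: complex) = 1"
    by (rule fps_ext) (simp add: ring_distribs fps_one_nth)
  ultimately show ?thesis
    by (simp add: mult.left_commute)
qed

text \<open>The ratio of consecutive coefficients of the hypergeometric series 2F1(x, -x; 1; t); the
  factor on the right is (x - n)(-x - n).\<close>

lemma gbinomial_product_rec:
  fixes x :: "'a :: field_char_0"
  shows "(of_nat (Suc n))\<^sup>2 * ((x gchoose Suc n) * (- x gchoose Suc n))
    = ((of_nat n)\<^sup>2 - x\<^sup>2) * ((x gchoose n) * (- x gchoose n))"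
proof -
  have "of_nat (Suc n) * (a gchoose Suc n) = (a - of_nat n) * (a gchoose n)" for a :: 'a
    using gbinomial_mult_1[of a n] by (simp add: algebra_simps)
  from this[of x] this[of "- x"]
  have "(of_nat (Suc n) * (x gchoose Suc n)) * (of_nat (Suc n) * (- x gchoose Suc n))
      = ((x - of_nat n) * (x gchoose n)) * ((- x - of_nat n) * (- x gchoose n))"
    by simp
  then show ?thesis
    by (simp add: power2_eq_square algebra_simps)
qed

text \<open>If \<open>E' = - G E\<close>, the Riccati equation for \<open>G\<close> becomes the hypergeometric equation
  \<open>(1 - X) (X E')' = - x\<^sup>2 E\<close>, which determines \<open>E\<close> from \<open>E(0) = 1\<close>.\<close>
lemma exp_riccati_fps_nth:
  "(fps_exp 1 oo - fps_integral0 (riccati_fps x)) $ n = (x gchoose n) * (- x gchoose n)"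
proof -
  define G where "G = riccati_fps x"
  define E where "E = fps_exp 1 oo - fps_integral0 G"
  have E': "fps_deriv E = - G * E"
    unfolding E_def
    by (subst fps_compose_deriv) (simp_all add: fps_deriv_fps_integral)
  have "(1 - fps_X) * fps_deriv (fps_X * fps_deriv E)
      = - ((1 - fps_X) * (fps_X * fps_deriv G + G - fps_X * G ^ 2)) * E"
    by (simp add: E' algebra_simps power2_eq_square)
  also have "\<dots> = - fps_const (x\<^sup>2) * E"
    using riccati_fps_ode[of x] by (simp add: G_def)
  finally have ode: "(1 - fps_X) * fps_deriv (fps_X * fps_deriv E) = - fps_const (x\<^sup>2) * E" .
  \<comment> \<open>The coefficient of X^n in (X E')' is (n + 1)^2 E_{n+1}, and the factor 1 - X
    subtracts n^2 E_n.\<close>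
  have rec: "(of_nat (Suc n))\<^sup>2 * E $ Suc n = ((of_nat n)\<^sup>2 - x\<^sup>2) * E $ n" for n
    using arg_cong[OF ode, of "\<lambda>f. f $ n"]
    by (cases n) (simp_all add: algebra_simps power2_eq_square)
  have "E $ n = (x gchoose n) * (- x gchoose n)"
  proof (induction n)
    case 0
    show ?case by (simp add: E_def)
  next
    case (Suc n)
    have "(of_nat (Suc n))\<^sup>2 * E $ Suc n = (of_nat (Suc n))\<^sup>2 * ((x gchoose Suc n) * (- x gchoose Suc n))"
      by (simp only: rec gbinomial_product_rec Suc)
    then show ?case
      by (simp del: of_nat_Suc)
  qed
  then show ?thesis
    by (simp add: E_def G_def)
qed

section \<open>Convergence of the logarithmic series and its exponential\<close>

lemma integral_riccati_fps_nth:
  "fps_integral0 (riccati_fps x) $ n = poly (Q n) x / (fact n)\<^sup>2"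
  \<comment> \<open>For \<open>n = 0\<close> both sides vanish because of the dummy value
    \<open>Q 0 = 0\<close>; this lets the series start at index 0.\<close>
  by (cases n) (simp_all add: riccati_fps_def power2_eq_square divide_simps)

text \<open>The radius \<open>r\<close> is kept free, instead of being
  \<open>max 1 (norm x)\<close>, so that the same geometric majorant holds uniformly for all
  \<open>x\<close> in a disc, as the Weierstrass M-test requires later.\<close>

lemma norm_poly_Q_term_le:
  assumes "norm x \<le> r" "1 \<le> r"
  shows "norm (poly (Q n) x / (fact n)\<^sup>2 * t ^ n) \<le> (r\<^sup>2 * norm t) ^ n"
proof (cases "n = 0")
  case False
  have "norm (poly (Q n) x) \<le> fact n * fact (n - 1) * max 1 (norm x) ^ (2 * n)"
    using False by (intro norm_poly_Q_le) auto
  also have "\<dots> \<le> fact n * fact n * r ^ (2 * n)"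
    using assms by (intro mult_mono power_mono fact_mono) auto
  finally have "norm (poly (Q n) x) / (fact n)\<^sup>2 \<le> r ^ (2 * n)"
    by (simp add: divide_le_eq power2_eq_square mult_ac)
  then have "norm (poly (Q n) x) / (fact n)\<^sup>2 * norm t ^ n \<le> r ^ (2 * n) * norm t ^ n"
    by (intro mult_right_mono) auto
  then show ?thesis
    by (simp add: norm_mult norm_divide norm_power power_mult power_mult_distrib)
qed simp

text \<open>Turns the formal identity for \<open>fps_exp 1 oo - H\<close> into a convergent one:
  \<open>exp\<close> of the sum of \<open>- H\<close> is holomorphic on a disc containing
  \<open>t\<close>, so its Taylor series, which is the formal composition, converges to it
  there.\<close>

lemma gbinomial_product_sums_exp:
  assumes "(max 1 (norm x))\<^sup>2 * norm t < 1"
  shows "(\<lambda>n. (x gchoose n) * (- x gchoose n) * t ^ n)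
           sums exp (- (\<Sum>n. poly (Q n) x / (fact n)\<^sup>2 * t ^ n))"
proof -
  let ?M = "max 1 (norm x)"
  define H where "H = fps_integral0 (riccati_fps x)"
  \<comment> \<open>The radius up to which the majorant \<open>(?M\<^sup>2 * norm t) ^ n\<close> is
    summable.\<close>
  define R where "R = 1 / ?M\<^sup>2"
  have "?M > 0" by simp
  have R: "R > 0"
    by (simp add: R_def)
  have conv: "fps_conv_radius (- H) \<ge> ereal R"
    unfolding fps_conv_radius_uminus
    unfolding fps_conv_radius_def
  proof (rule conv_radius_geI_ex')
    fix s :: real assume s: "0 < s" "ereal s < ereal R"
    then have "?M\<^sup>2 * norm (complex_of_real s) < 1"
      by (simp add: R_def field_simps)
    then show "summable (\<lambda>n. H $ n * complex_of_real s ^ n)"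
      unfolding H_def integral_riccati_fps_nth
      by (intro summable_comparison_test[OF _ summable_geometric, of _ "?M\<^sup>2 * norm (complex_of_real s)"]
            exI[of _ 0] allI impI norm_poly_Q_term_le) auto
  qed
  let ?f = "exp \<circ> eval_fps (- H)"
  have "0 < fps_conv_radius (- H)"
    using R conv by (metis ereal_less(2) less_le_trans)
  then have "?f has_fps_expansion (fps_exp 1 oo - H)"
    by (intro has_fps_expansion_compose has_fps_expansion_exp1 eval_fps_has_fps_expansion)
       (auto simp: H_def)
  moreover have "?f holomorphic_on eball 0 (ereal R)"
    using eball_mono[OF conv] unfolding o_def
    by (intro holomorphic_intros)
  moreover have "ereal (norm t) < ereal R"
    using assms \<open>?M > 0\<close> by (simp add: R_def field_simps)
  ultimately have "(\<lambda>n. (fps_exp 1 oo - H) $ n * t ^ n) sums ?f t"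
    by (rule has_fps_expansion_imp_sums_complex)
  moreover have "eval_fps (- H) t = - (\<Sum>n. poly (Q n) x / (fact n)\<^sup>2 * t ^ n)"
  proof -
    have "eval_fps (- H) t = - eval_fps H t"
      using less_le_trans[OF \<open>ereal (norm t) < ereal R\<close> conv] by (intro eval_fps_minus) simp
    then show ?thesis
      by (simp add: eval_fps_def H_def integral_riccati_fps_nth)
  qed
  ultimately show ?thesis
    by (simp add: H_def exp_riccati_fps_nth)
qed

section \<open>Orthogonality on the circle and the series for the integral\<close>

lemma has_integral_exp_int_multiple:
  fixes k :: int
  shows "((\<lambda>\<theta>. exp (\<i> * of_int k * of_real \<theta>)) has_integral (if k = 0 then of_real (2 * pi) else 0))
           {0..2*pi}"
proof (cases "k = 0")
  case True
  then show ?thesis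
    using has_integral_const_real[of "1::complex" 0 "2 * pi"] by (simp add: scaleR_conv_of_real)
next
  case False
  let ?F = "\<lambda>\<theta>::real. exp (\<i> * of_int k * of_real \<theta>) / (\<i> * of_int k)"
  have "((\<lambda>\<theta>. exp (\<i> * of_int k * of_real \<theta>)) has_integral (?F (2 * pi) - ?F 0)) {0..2*pi}"
    using False
    by (intro fundamental_theorem_of_calculus)
       (auto intro!: derivative_eq_intros has_vector_derivative_real_field simp: field_simps)
  moreover have "exp (\<i> * of_int k * of_real (2 * pi)) = 1"
    using exp_two_pi_i' exp_integer_2pi[of "of_int k"] by (simp add: mult_ac)
  ultimately show ?thesis
    using False by simp
qed

text \<open>A bilinear form of Parseval's identity. For partial sums, orthogonality leaves only the
  diagonal terms, with c^n c^n = (c^2)^n; uniform convergence on the circle allows the limit to be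
  taken under the integral.\<close>

lemma integral_powser_product_circle:
  fixes f g :: "nat \<Rightarrow> complex" and c :: complex
  assumes "norm c < conv_radius f" "norm c < conv_radius g"
  shows "(\<lambda>n. f n * g n * (c\<^sup>2) ^ n) sums
    (1 / (2 * of_real pi) *
     integral {0..2*pi} (\<lambda>\<theta>. (\<Sum>n. f n * (c * exp (\<i> * of_real \<theta>)) ^ n) *
                               (\<Sum>n. g n * (c * exp (- \<i> * of_real \<theta>)) ^ n)))"
proof -
  let ?u = "\<lambda>\<theta>::real. c * exp (\<i> * of_real \<theta>)" and ?v = "\<lambda>\<theta>::real. c * exp (- \<i> * of_real \<theta>)"
  \<comment> \<open>Stated for any continuous path \<open>w\<close> of constant modulus so as to
    serve both \<open>?u\<close> and \<open>?v\<close>. Boundedness is included because a product of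
    uniform limits is a uniform limit only when the limit functions are bounded.\<close>
  have powser: "uniform_limit {0..2*pi} (\<lambda>N \<theta>. \<Sum>n<N. a n * (w \<theta>) ^ n) (\<lambda>\<theta>. \<Sum>n. a n * (w \<theta>) ^ n) sequentially
      \<and> bounded ((\<lambda>\<theta>. \<Sum>n. a n * (w \<theta>) ^ n) ` {0..2*pi})"
    if "norm c < conv_radius a" "\<And>\<theta>. norm (w \<theta>) = norm c" "continuous_on {0..2*pi} w"
    for a :: "nat \<Rightarrow> complex" and w :: "real \<Rightarrow> complex"
  proof
    have "uniform_limit (cball 0 (norm c)) (\<lambda>N z. \<Sum>n<N. a n * z ^ n) (\<lambda>z. \<Sum>n. a n * z ^ n) sequentially"
      using powser_uniform_limit[OF that(1), of 0] by simp
    from uniform_limit_compose'[OF this, of w "{0..2*pi}"] that(2)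
    show *: "uniform_limit {0..2*pi} (\<lambda>N \<theta>. \<Sum>n<N. a n * (w \<theta>) ^ n) (\<lambda>\<theta>. \<Sum>n. a n * (w \<theta>) ^ n) sequentially"
      by simp
    show "bounded ((\<lambda>\<theta>. \<Sum>n. a n * (w \<theta>) ^ n) ` {0..2*pi})"
      using that(3)
      by (intro uniform_limit_bounded[OF *] always_eventually allI compact_imp_bounded
            compact_continuous_image continuous_intros) auto
  qed
  have lim: "uniform_limit {0..2*pi} (\<lambda>N \<theta>. (\<Sum>n<N. f n * ?u \<theta> ^ n) * (\<Sum>n<N. g n * ?v \<theta> ^ n))
      (\<lambda>\<theta>. (\<Sum>n. f n * ?u \<theta> ^ n) * (\<Sum>n. g n * ?v \<theta> ^ n)) sequentially"
  proof -
    have "norm (?u \<theta>) = norm c" "norm (?v \<theta>) = norm c" for \<theta>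
      by (simp_all add: norm_mult)
    moreover have "continuous_on {0..2*pi} ?u" "continuous_on {0..2*pi} ?v"
      by (intro continuous_intros)+
    ultimately show ?thesis
      using powser[OF assms(1), of ?u] powser[OF assms(2), of ?v]
      by (intro uniform_lim_mult) blast+
  qed
  have cont: "continuous_on {0..2*pi} (\<lambda>\<theta>. (\<Sum>n<N. f n * ?u \<theta> ^ n) * (\<Sum>n<N. g n * ?v \<theta> ^ n))" for N
    by (intro continuous_intros)
  obtain I J where
    I: "\<And>N. ((\<lambda>\<theta>. (\<Sum>n<N. f n * ?u \<theta> ^ n) * (\<Sum>n<N. g n * ?v \<theta> ^ n)) has_integral I N) {0..2*pi}" and
    J: "((\<lambda>\<theta>. (\<Sum>n. f n * ?u \<theta> ^ n) * (\<Sum>n. g n * ?v \<theta> ^ n)) has_integral J) {0..2*pi}" and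
    IJ: "I \<longlonglongrightarrow> J"
    using uniform_limit_integral[OF lim cont] by auto
  have "I N = 2 * of_real pi * (\<Sum>n<N. f n * g n * (c\<^sup>2) ^ n)" for N
  proof -
    have product: "(\<Sum>n<N. f n * ?u \<theta> ^ n) * (\<Sum>n<N. g n * ?v \<theta> ^ n) =
        (\<Sum>m<N. \<Sum>n<N. f m * g n * c ^ (m + n) * exp (\<i> * of_int (int m - int n) * of_real \<theta>))" for \<theta>
    proof -
      have "exp (\<i> * of_real \<theta>) ^ m * exp (- \<i> * of_real \<theta>) ^ n
          = exp (\<i> * of_int (int m - int n) * of_real \<theta>)" for m n
        by (simp add: algebra_simps flip: exp_of_nat_mult exp_add)
      then show ?thesis
        by (simp add: sum_product power_mult_distrib power_add mult_ac)
    qed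
    have "((\<lambda>\<theta>. (\<Sum>n<N. f n * ?u \<theta> ^ n) * (\<Sum>n<N. g n * ?v \<theta> ^ n)) has_integral
        (\<Sum>m<N. \<Sum>n<N. f m * g n * c ^ (m + n) * (if int m - int n = 0 then of_real (2 * pi) else 0))) {0..2*pi}"
      unfolding product
      by (intro has_integral_sum has_integral_mult_right has_integral_exp_int_multiple) auto
    also have "(\<Sum>m<N. \<Sum>n<N. f m * g n * c ^ (m + n) * (if int m - int n = 0 then of_real (2 * pi) else 0))
        = (\<Sum>m<N. \<Sum>n<N. if m = n then f m * g n * c ^ (m + n) * of_real (2 * pi) else 0)"
      by (intro sum.cong) auto
    also have "\<dots> = 2 * of_real pi * (\<Sum>n<N. f n * g n * (c\<^sup>2) ^ n)"
    proof -
      have "c ^ (m + m) = (c\<^sup>2) ^ m" for m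
        by (simp add: power_mult flip: mult_2)
      then show ?thesis
        by (simp add: sum_distrib_left mult_ac)
    qed
    finally show ?thesis
      using I has_integral_unique by blast
  qed
  then have "(\<lambda>N. \<Sum>n<N. f n * g n * (c\<^sup>2) ^ n) = (\<lambda>N. 1 / (2 * of_real pi) * I N)"
    by (simp add: fun_eq_iff)
  moreover have "(\<lambda>N. 1 / (2 * of_real pi) * I N) \<longlonglongrightarrow> 1 / (2 * of_real pi) * J"
    by (intro tendsto_intros IJ)
  ultimately show ?thesis
    using integral_unique[OF J] by (simp add: sums_def)
qed

text \<open>Off the cut, conjugation commutes with \<open>Ln\<close>, so
  \<open>Ln w - cnj (Ln w)\<close> is 2i times the argument. This factor 2 is the reason for
  evaluating the integral at \<open>2 * x\<close>.\<close>

lemma exp_Arg_eq_powr: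
  assumes "w \<notin> \<real>\<^sub>\<le>\<^sub>0"
  shows "exp (- \<i> * (2 * x) * of_real (Arg w)) = w powr (- x) * cnj w powr x"
proof -
  have "w \<noteq> 0"
    using assms by auto
  have "Ln w - cnj (Ln w) = 2 * \<i> * of_real (Arg w)"
    using Arg_eq_Im_Ln[OF \<open>w \<noteq> 0\<close>] by (simp add: complex_eq_iff)
  moreover have "w powr (- x) * cnj w powr x = exp (- (x * (Ln w - cnj (Ln w))))"
    using assms \<open>w \<noteq> 0\<close> by (simp add: powr_def cnj_Ln right_diff_distrib flip: exp_add)
  ultimately show ?thesis
    by (simp only:) (simp add: mult_ac)
qed

lemma arg_integral_sums:
  assumes "b > 1"
  shows "(\<lambda>n. (x gchoose n) * (- x gchoose n) * (1 / of_real b ^ 2) ^ n) sums arg_integral b (2 * x)"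
proof -
  \<comment> \<open>The sign goes into \<open>c\<close> because the binomial series expands powers
    of 1 + z. As \<open>c\<close> is real, conjugating
    \<open>1 + c * exp (\<i> * of_real \<theta>)\<close> only flips the sign of \<theta>.\<close>
  define c :: complex where "c = - 1 / of_real b"
  have norm_c: "norm c < 1"
    using assms by (simp add: c_def norm_divide)
  have conv: "norm c < conv_radius (\<lambda>n. a gchoose n)" for a :: complex
    using norm_c by (auto simp: conv_radius_gchoose)
  have binomial: "(\<Sum>n. (a gchoose n) * (c * e) ^ n) = (1 + c * e) powr a" if "norm e = 1" for a e
    using norm_c that by (intro sums_unique[symmetric] gen_binomial_complex) (simp add: norm_mult)
  have "exp (- \<i> * (2 * x) * of_real (Arg (1 - exp (\<i> * of_real \<theta>) / of_real b)))
      = (\<Sum>n. (- x gchoose n) * (c * exp (\<i> * of_real \<theta>)) ^ n) *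
        (\<Sum>n. (x gchoose n) * (c * exp (- \<i> * of_real \<theta>)) ^ n)" for \<theta>
  proof -
    define w where "w = 1 + c * exp (\<i> * of_real \<theta>)"
    have "\<bar>Re (c * exp (\<i> * of_real \<theta>))\<bar> < 1"
      using abs_Re_le_cmod[of "c * exp (\<i> * of_real \<theta>)"] norm_c by (simp add: norm_mult)
    then have "w \<notin> \<real>\<^sub>\<le>\<^sub>0"
      unfolding w_def complex_nonpos_Reals_iff plus_complex.sel one_complex.sel by linarith
    moreover have "cnj w = 1 + c * exp (- \<i> * of_real \<theta>)"
      by (simp add: w_def c_def exp_cnj)
    ultimately have "exp (- \<i> * (2 * x) * of_real (Arg w))
        = (1 + c * exp (\<i> * of_real \<theta>)) powr (- x) * (1 + c * exp (- \<i> * of_real \<theta>)) powr x"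
      using exp_Arg_eq_powr[of w x] w_def by metis
    moreover have "w = 1 - exp (\<i> * of_real \<theta>) / of_real b"
      by (simp add: w_def c_def)
    ultimately show ?thesis
      by (simp add: binomial)
  qed
  then have "arg_integral b (2 * x) = 1 / (2 * of_real pi) * integral {0..2*pi}
      (\<lambda>\<theta>. (\<Sum>n. (- x gchoose n) * (c * exp (\<i> * of_real \<theta>)) ^ n) *
             (\<Sum>n. (x gchoose n) * (c * exp (- \<i> * of_real \<theta>)) ^ n))"
    by (simp add: arg_integral_def)
  moreover have "c\<^sup>2 = 1 / of_real b ^ 2"
    by (simp add: c_def power_divide)
  ultimately show ?thesis
    using integral_powser_product_circle[OF conv[of "- x"] conv[of x]] by (simp add: mult_ac)
qed

section \<open>Parity, degree and integrality of the coefficients of \<open>Q\<close>\<close>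

lemma Nats_add_nonzero:
  fixes a b :: "'a :: semiring_char_0"
  assumes "a \<in> \<nat>" "b \<in> \<nat>" "a \<noteq> 0"
  shows "a + b \<noteq> 0"
  using assms by (auto elim!: Nats_cases simp flip: of_nat_add)

lemma sum_in_Nats:
  assumes "\<And>i. i \<in> A \<Longrightarrow> f i \<in> \<nat>"
  shows "sum f A \<in> \<nat>"
  using assms by (induction A rule: infinite_finite_induct) auto

text \<open>An invariant that is stable under the operations of the recursion. The degree is only
  bounded above; equality is proved separately in \<open>even_Nats_poly_Q\<close>.\<close>

definition even_Nats_poly :: "nat \<Rightarrow> 'a :: {idom, semiring_char_0} poly \<Rightarrow> bool" where
  "even_Nats_poly d p \<longleftrightarrow>
     (\<forall>i. coeff p i \<in> \<nat>) \<and> (\<forall>i. odd i \<longrightarrow> coeff p i = 0) \<and> coeff p 0 = 0 \<and> degree p \<le> 2 * d"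

lemma even_Nats_poly_0: "even_Nats_poly d 0"
  by (simp add: even_Nats_poly_def)

lemma even_Nats_poly_monom:
  assumes "a \<in> \<nat>" "d \<ge> 1"
  shows "even_Nats_poly d (monom a 2)"
  using assms degree_monom_le[of a 2] by (auto simp: even_Nats_poly_def)

lemma even_Nats_poly_add:
  assumes "even_Nats_poly d p" "even_Nats_poly d q"
  shows "even_Nats_poly d (p + q)"
  using assms by (auto simp: even_Nats_poly_def intro: degree_add_le)

lemma even_Nats_poly_sum:
  assumes "\<And>j. j \<in> A \<Longrightarrow> even_Nats_poly d (p j)"
  shows "even_Nats_poly d (\<Sum>j\<in>A. p j)"
  using assms
  by (induction A rule: infinite_finite_induct) (auto intro: even_Nats_poly_0 even_Nats_poly_add)

lemma even_Nats_poly_mult: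
  assumes "even_Nats_poly d p" "even_Nats_poly e q"
  shows "even_Nats_poly (d + e) (p * q)"
  unfolding even_Nats_poly_def
proof (intro conjI allI impI)
  show "coeff (p * q) i \<in> \<nat>" for i
    using assms by (auto simp: coeff_mult even_Nats_poly_def intro!: sum_in_Nats)
  show "coeff (p * q) i = 0" if "odd i" for i
    unfolding coeff_mult
  proof (intro sum.neutral ballI)
    fix j assume "j \<in> {..i}"
    then have "odd j \<or> odd (i - j)"
      using that by auto
    then show "coeff p j * coeff q (i - j) = 0"
      using assms by (elim disjE) (simp_all add: even_Nats_poly_def)
  qed
  show "coeff (p * q) 0 = 0"
    using assms by (simp add: coeff_mult even_Nats_poly_def)
  show "degree (p * q) \<le> 2 * (d + e)"
    using assms degree_mult_le[of p q] by (simp add: even_Nats_poly_def)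
qed

lemma even_Nats_poly_of_nat_mult:
  assumes "even_Nats_poly d p"
  shows "even_Nats_poly d (of_nat k * p)"
  using assms even_Nats_poly_0 by (induction k) (auto simp: ring_distribs intro: even_Nats_poly_add)

text \<open>The invariant gives the upper bound on the degree. For equality, the summand
  \<open>j = 0\<close> of the recursion is m x^2 Q_m with m = n - 1, which already has degree 2n;
  all other coefficients are natural numbers, so its leading term cannot cancel.\<close>

lemma even_Nats_poly_Q:
  assumes "n \<ge> 1"
  shows "even_Nats_poly n (Q n) \<and> degree (Q n) = 2 * n"
  using assms
proof (induction n rule: less_induct)
  case (less n)
  show ?case
  proof (cases "n = 1")
    case True
    then show ?thesis
      by (auto simp: degree_monom_eq intro: even_Nats_poly_monom)
  next
    case False
    define m where "m = n - 1"
    have m: "n = m + 1" "m \<ge> 1"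
      using False less.prems by (auto simp: m_def)
    define T where "T j = of_nat ((m choose j) * (m choose (j + 1))) * Q (j + 1) * Q (m - j)" for j
    have T: "even_Nats_poly n (T j)" if "j < m" for j
    proof -
      have "even_Nats_poly (j + 1 + (m - j)) (Q (j + 1) * Q (m - j))"
        using less.IH[of "j + 1"] less.IH[of "m - j"] that m by (intro even_Nats_poly_mult) auto
      then show ?thesis
        using that m by (auto simp: T_def mult.assoc simp del: of_nat_mult intro: even_Nats_poly_of_nat_mult)
    qed
    define U where "U = monom ((fact m)\<^sup>2) 2 + (\<Sum>j\<in>{1..<m}. T j)"
    have "{0..m-1} = insert 0 {1..<m}"
      using m by auto
    then have Q_n: "Q n = T 0 + U"
      unfolding m(1) Q_rec[OF m(2)] by (simp add: T_def U_def)
    have "((fact m)\<^sup>2 :: complex) = of_nat ((fact m)\<^sup>2)"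
      by simp
    then have "((fact m)\<^sup>2 :: complex) \<in> \<nat>"
      by (metis of_nat_in_Nats)
    then have rest: "even_Nats_poly n U"
      unfolding U_def using T m
      by (intro even_Nats_poly_add even_Nats_poly_sum even_Nats_poly_monom) auto
    have even: "even_Nats_poly n (Q n)"
      unfolding Q_n using T[of 0] m by (intro even_Nats_poly_add[OF _ rest]) simp
    have T_0: "T 0 = smult (of_nat m) (monom 1 2 * Q m)"
      by (simp add: T_def of_nat_poly)
    have "degree (Q m) = 2 * m"
      using less.IH[of m] m by simp
    with m have "Q m \<noteq> 0" by auto
    then have "degree (T 0) = 2 * n" and "T 0 \<noteq> 0"
      using m \<open>degree (Q m) = 2 * m\<close> by (auto simp: T_0 degree_mult_eq degree_monom_eq)
    then have "coeff (T 0) (2 * n) \<noteq> 0"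
      by (metis leading_coeff_0_iff)
    with T[of 0] rest m have "coeff (Q n) (2 * n) \<noteq> 0"
      unfolding Q_n coeff_add by (intro Nats_add_nonzero) (auto simp: even_Nats_poly_def)
    with even show ?thesis
      by (auto simp: even_Nats_poly_def intro: antisym le_degree)
  qed
qed

lemma poly_Q_0: "poly (Q n) 0 = 0"
proof (cases "n = 0")
  case False
  then show ?thesis
    using even_Nats_poly_Q[of n] by (simp add: even_Nats_poly_def poly_0_coeff_0)
qed simp

text \<open>The choice only inverts \<open>of_nat\<close>, which is injective into the complex
  numbers.\<close>

definition Q_coeff :: "nat \<Rightarrow> nat \<Rightarrow> nat" where
  "Q_coeff n k = (SOME m. coeff (Q n) (2 * k) = of_nat m)"

lemma of_nat_Q_coeff:
  assumes "n \<ge> 1"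
  shows "of_nat (Q_coeff n k) = coeff (Q n) (2 * k)"
proof -
  have "coeff (Q n) (2 * k) \<in> \<nat>"
    using even_Nats_poly_Q[OF assms] by (simp add: even_Nats_poly_def)
  then have "\<exists>m. coeff (Q n) (2 * k) = of_nat m"
    by (auto elim: Nats_cases)
  then show ?thesis
    unfolding Q_coeff_def by (rule someI_ex[THEN sym])
qed

lemma Q_eq_sum_monom:
  assumes "n \<ge> 1"
  shows "Q n = (\<Sum>k=1..n. monom (of_nat (Q_coeff n k)) (2 * k))"
proof (rule poly_eqI)
  fix i
  have Q: "\<And>i. odd i \<Longrightarrow> coeff (Q n) i = 0" "coeff (Q n) 0 = 0" "degree (Q n) = 2 * n"
    using even_Nats_poly_Q[OF assms] by (auto simp: even_Nats_poly_def)
  have "coeff (\<Sum>k=1..n. monom (of_nat (Q_coeff n k)) (2 * k)) i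
      = (\<Sum>k=1..n. if 2 * k = i then coeff (Q n) i else 0)"
    by (auto simp: coeff_sum of_nat_Q_coeff[OF assms] intro!: sum.cong)
  also have "\<dots> = coeff (Q n) i"
  proof (cases "\<exists>k\<in>{1..n}. i = 2 * k")
    case True
    then obtain k where "k \<in> {1..n}" "i = 2 * k" by blast
    then show ?thesis by simp
  next
    case False
    have "coeff (Q n) i = 0"
    proof (cases "even i \<and> i \<noteq> 0")
      case True
      with False have "i > degree (Q n)"
        unfolding Q(3) by (auto elim!: evenE)
      then show ?thesis by (rule coeff_eq_0)
    qed (use Q in auto)
    with False show ?thesis by (auto intro!: sum.neutral)
  qed
  finally show "coeff (Q n) i = coeff (\<Sum>k=1..n. monom (of_nat (Q_coeff n k)) (2 * k)) i" ..
qed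

lemma poly_Q_eq_sum:
  assumes "n \<ge> 1"
  shows "poly (Q n) x = (\<Sum>k=1..n. of_nat (Q_coeff n k) * x ^ (2 * k))"
  by (subst Q_eq_sum_monom[OF assms]) (simp add: poly_sum poly_monom)

section \<open>Existence and uniqueness of the analytic logarithm\<close>

definition log_series :: "real \<Rightarrow> complex \<Rightarrow> complex" where
  "log_series b x = - (\<Sum>n. poly (Q n) x / (fact n)\<^sup>2 * (1 / of_real b ^ 2) ^ n)"

lemma log_series_ratio:
  assumes "1 \<le> r" "r < b"
  shows "r\<^sup>2 * norm (1 / complex_of_real b ^ 2) < 1"
  using assms by (simp add: norm_divide norm_power power_strict_mono)

lemma log_series_sums:
  assumes "max 1 (norm x) < b"
  shows "(\<lambda>n. poly (Q (Suc n)) x / (fact (Suc n))\<^sup>2 * (1 / of_real b ^ (2 * Suc n))) sums (- log_series b x)"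
proof -
  let ?t = "1 / complex_of_real b ^ 2"
  let ?f = "\<lambda>n. poly (Q n) x / (fact n)\<^sup>2 * ?t ^ n"
  have "(max 1 (norm x))\<^sup>2 * norm ?t < 1"
    using assms by (intro log_series_ratio) auto
  then have "summable (\<lambda>n. ((max 1 (norm x))\<^sup>2 * norm ?t) ^ n)"
    by (intro summable_geometric) simp
  then have "summable ?f"
    by (rule summable_comparison_test[rotated]) (intro exI[of _ 0] allI impI norm_poly_Q_term_le; simp)
  then have "?f sums (- log_series b x)"
    by (simp add: log_series_def summable_sums)
  \<comment> \<open>Dropping the term at index 0 does not change the sum, since
    \<open>Q 0 = 0\<close>.\<close>
  then have "(\<lambda>n. ?f (Suc n)) sums (- log_series b x)"
    by (subst sums_Suc_iff) simp
  then show ?thesis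
    by (simp only: power_one_over power_mult)
qed

lemma holomorphic_on_log_series:
  assumes "b > 1"
  shows "log_series b holomorphic_on ball 0 b"
proof -
  let ?t = "1 / complex_of_real b ^ 2"
  have "(\<lambda>x. \<Sum>n. poly (Q n) x / (fact n)\<^sup>2 * ?t ^ n) holomorphic_on ball 0 b"
  proof (rule holomorphic_uniform_sequence)
    show "(\<lambda>x. \<Sum>n<N. poly (Q n) x / (fact n)\<^sup>2 * ?t ^ n) holomorphic_on ball 0 b" for N
      by (intro holomorphic_intros) auto
    fix x :: complex assume x: "x \<in> ball 0 b"
    \<comment> \<open>Half the distance to the boundary keeps the closed disc around
      \<open>x\<close> inside the open one; \<open>r\<close> then dominates 1 and every modulus on
      that closed disc while staying below \<open>b\<close>, so one geometric series majorises all
      terms.\<close>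
    define d where "d = (b - norm x) / 2"
    define r where "r = max 1 (norm x + d)"
    have d: "d > 0" "norm x + d < b"
      using x by (auto simp: d_def field_simps)
    have r: "1 \<le> r" "r < b"
      using d assms by (auto simp: r_def)
    have norm_le: "norm y \<le> norm x + d" if "y \<in> cball x d" for y
      using that norm_triangle_ineq[of x "y - x"] by (simp add: dist_norm norm_minus_commute)
    have "uniform_limit (cball x d) (\<lambda>N y. \<Sum>n<N. poly (Q n) y / (fact n)\<^sup>2 * ?t ^ n)
        (\<lambda>y. \<Sum>n. poly (Q n) y / (fact n)\<^sup>2 * ?t ^ n) sequentially"
    proof (rule Weierstrass_m_test)
      show "norm (poly (Q n) y / (fact n)\<^sup>2 * ?t ^ n) \<le> (r\<^sup>2 * norm ?t) ^ n" if "y \<in> cball x d" for n y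
        using norm_le[OF that] r by (intro norm_poly_Q_term_le) (auto simp: r_def)
      show "summable (\<lambda>n. (r\<^sup>2 * norm ?t) ^ n)"
        using log_series_ratio[OF r] by (intro summable_geometric) simp
    qed
    moreover have "cball x d \<subseteq> ball 0 b"
      using norm_le d by fastforce
    ultimately show "\<exists>d>0. cball x d \<subseteq> ball 0 b \<and>
        uniform_limit (cball x d) (\<lambda>N y. \<Sum>n<N. poly (Q n) y / (fact n)\<^sup>2 * ?t ^ n)
          (\<lambda>y. \<Sum>n. poly (Q n) y / (fact n)\<^sup>2 * ?t ^ n) sequentially"
      using d by blast
  qed auto
  then show ?thesis
    unfolding log_series_def by (rule holomorphic_on_minus)
qed

lemma is_log_arg_integral_log_series:
  assumes "b > 1"
  shows "is_log_arg_integral b (log_series b)"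
  unfolding is_log_arg_integral_def
proof (intro conjI ballI)
  show "log_series b holomorphic_on ball 0 b"
    using assms by (rule holomorphic_on_log_series)
  show "log_series b 0 = 0"
    by (simp add: log_series_def poly_Q_0)
  fix x :: complex assume "x \<in> ball 0 b"
  then have "(max 1 (norm x))\<^sup>2 * norm (1 / complex_of_real b ^ 2) < 1"
    using assms by (intro log_series_ratio) auto
  \<comment> \<open>The hypergeometric series at t = 1 / b^2 sums both to the exponential and to the
    integral.\<close>
  from sums_unique2[OF gbinomial_product_sums_exp[OF this] arg_integral_sums[OF assms]]
  show "exp (log_series b x) = arg_integral b (2 * x)"
    by (simp add: log_series_def)
qed

text \<open>The difference \<open>f x - g x\<close> is continuous with values differing by multiples
  of 2 pi i. Distinct values are at least 2 pi apart, so on a connected set it is constant, and it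
  vanishes at \<open>a\<close>.\<close>

lemma exp_eq_imp_eq_on_connected:
  fixes f g :: "'a :: topological_space \<Rightarrow> complex"
  assumes "connected S" "continuous_on S f" "continuous_on S g"
    and eq: "\<And>x. x \<in> S \<Longrightarrow> exp (f x) = exp (g x)"
    and "a \<in> S" "f a = g a" "x \<in> S"
  shows "f x = g x"
proof -
  have "(\<lambda>x. f x - g x) constant_on S"
  proof (rule continuous_discrete_range_constant[OF assms(1)])
    fix x assume x: "x \<in> S"
    have "2 * pi \<le> norm ((f y - g y) - (f x - g x))"
      if y: "y \<in> S" "f y - g y \<noteq> f x - g x" for y
    proof -
      have "exp ((f y - g y) - (f x - g x)) = 1"
        using eq[OF x] eq[OF y(1)] by (simp add: exp_diff)
      then obtain n :: int where n: "Re ((f y - g y) - (f x - g x)) = 0"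
        "Im ((f y - g y) - (f x - g x)) = of_int (2 * n) * pi"
        unfolding exp_eq_1 by blast
      have "n \<noteq> 0"
        using n y(2) by (auto simp: complex_eq_iff)
      then have "1 \<le> \<bar>real_of_int n\<bar>"
        by linarith
      then have "2 * pi \<le> \<bar>of_int (2 * n) * pi\<bar>"
        by (simp add: abs_mult)
      also have "\<dots> \<le> norm ((f y - g y) - (f x - g x))"
        using abs_Im_le_cmod[of "(f y - g y) - (f x - g x)"] n by simp
      finally show ?thesis .
    qed
    then show "\<exists>e>0. \<forall>y. y \<in> S \<and> f y - g y \<noteq> f x - g x \<longrightarrow> e \<le> norm (f y - g y - (f x - g x))"
      by (intro exI[of _ "2 * pi"]) auto
  qed (intro continuous_intros assms)
  then have "f x - g x = f a - g a"
    using assms(5,7) unfolding constant_on_def by metis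
  then show ?thesis
    using assms by simp
qed

lemma is_log_arg_integral_unique:
  assumes "is_log_arg_integral b L" "is_log_arg_integral b L'" "x \<in> ball 0 b"
  shows "L x = L' x"
proof -
  \<comment> \<open>A ball that contains some \<open>x\<close> has positive radius, hence contains
    its centre, where both logarithms are normalised to 0.\<close>
  have "0 \<in> ball (0::complex) b"
    using assms(3) by (auto intro: le_less_trans[OF norm_ge_zero])
  with assms show ?thesis
    by (intro exp_eq_imp_eq_on_connected[of "ball 0 b" L L' 0 x])
       (auto simp: is_log_arg_integral_def holomorphic_on_imp_continuous_on)
qed

theorem theorem2:
  "\<exists>q :: nat \<Rightarrow> nat \<Rightarrow> nat.
     (\<forall>n\<ge>1. (\<forall>x. poly (Q n) (- x) = poly (Q n) x)
           \<and> degree (Q n) = 2 * n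
           \<and> poly (Q n) 0 = 0
           \<and> Q n = (\<Sum>k=1..n. monom (of_nat (q n k)) (2 * k))
           \<and> (\<forall>x. norm (poly (Q n) x) \<le> fact n * fact (n - 1) * (max 1 (norm x)) ^ (2 * n)))
   \<and> (\<forall>b::real. b > 1 \<longrightarrow>
        (\<exists>L. is_log_arg_integral b L) \<and>
        (\<forall>L. is_log_arg_integral b L \<longrightarrow>
          (\<forall>x::complex. b > max 1 (norm x) \<longrightarrow>
             (\<lambda>n. poly (Q (Suc n)) x / (fact (Suc n))^2 * (1 / of_real b ^ (2 * Suc n)))
               sums (- L x) \<and>
             (\<lambda>n. \<Sum>k=1..Suc n. of_nat (q (Suc n) k) / (fact (Suc n))^2
                                 * (x ^ (2 * k) / of_real b ^ (2 * Suc n)))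
               sums (- L x))))"
proof (intro exI[of _ Q_coeff] conjI allI impI)
  fix n :: nat and x :: complex assume n: "n \<ge> 1"
  show "poly (Q n) (- x) = poly (Q n) x"
    by (simp add: poly_Q_eq_sum[OF n])
  show "degree (Q n) = 2 * n"
    using even_Nats_poly_Q[OF n] by simp
  show "poly (Q n) 0 = 0"
    by (rule poly_Q_0)
  show "Q n = (\<Sum>k=1..n. monom (of_nat (Q_coeff n k)) (2 * k))"
    using n by (rule Q_eq_sum_monom)
  show "norm (poly (Q n) x) \<le> fact n * fact (n - 1) * (max 1 (norm x)) ^ (2 * n)"
    using n by (rule norm_poly_Q_le)
next
  fix b :: real assume "b > 1"
  then show "\<exists>L. is_log_arg_integral b L"
    using is_log_arg_integral_log_series by blast
next
  fix b :: real and L and x :: complex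
  assume b: "b > 1" and L: "is_log_arg_integral b L" and x: "b > max 1 (norm x)"
  \<comment> \<open>Uniqueness of the branch reduces the claim for arbitrary \<open>L\<close> to the
    explicit series.\<close>
  have "L x = log_series b x"
    using x by (intro is_log_arg_integral_unique[OF L is_log_arg_integral_log_series[OF b]]) simp
  then show *: "(\<lambda>n. poly (Q (Suc n)) x / (fact (Suc n))^2 * (1 / of_real b ^ (2 * Suc n))) sums (- L x)"
    using log_series_sums[OF x] by simp
  have "poly (Q (Suc n)) x / (fact (Suc n))^2 * (1 / of_real b ^ (2 * Suc n)) =
      (\<Sum>k=1..Suc n. of_nat (Q_coeff (Suc n) k) / (fact (Suc n))^2
                       * (x ^ (2 * k) / of_real b ^ (2 * Suc n)))" for n
    by (simp only: poly_Q_eq_sum[of "Suc n"] Suc_le_mono le0 One_nat_def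
          times_divide_times_eq mult_1_right sum_divide_distrib sum_distrib_right)
  with * show "(\<lambda>n. \<Sum>k=1..Suc n. of_nat (Q_coeff (Suc n) k) / (fact (Suc n))^2
                                 * (x ^ (2 * k) / of_real b ^ (2 * Suc n))) sums (- L x)"
    by (simp only:)
qed

end
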